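(* Let $n=1$, so $F$ is a nonzero real number and $\bar A=a_1>0$, and assume $a_1>F^2$. (i) If $F>0$, the generalized Kreiss condition (GKC) holds for $B=(B_u,B_p)$ with $B_u=1$ and $B_p$ a real number satisfying $B_p>\dfrac{1}{F-\sqrt{a_1}}$. (ii) If $F<0$, the GKC holds for every full-rank (i.e. nonzero) real $1\times2$ matrix $B=(B_u,B_p)$ satisfying $$B_p\tilde C+B_u(1-F^{-1}\tilde C)=0$$ with a real number $\tilde C>F-\dfrac{F^2}{\sqrt{a_1}}$.
   Context: Let $A=\begin{pmatrix}F&1\\ a_1-F^2&-F\end{pmatrix}$, $S=\mathrm{diag}(0,-1)$ and, for $\eta\ge0$ and $\xi_0\in\mathbb C$ with $\mathrm{Re}\,\xi_0>0$, $M(\eta,\xi_0)=A^{-1}(\eta S-\xi_0I_2)$, which has exactly one eigenvalue with negative real part. A right-stable matrix $R_M^S(\eta,\xi_0)$ is a nonzero vector in $\mathbb C^2$ that is an eigenvector of $M(\eta,\xi_0)$ for this eigenvalue. The GKC for a $1\times2$ matrix $B$: there is a constant $c_K>0$ such that $|\det\{BR_M^S(\eta,\xi_0)\}|\ge c_K\sqrt{\det\{R_M^{S*}(\eta,\xi_0)R_M^S(\eta,\xi_0)\}}$ for all $\eta\ge0$ and all $\xi_0$ with $\mathrm{Re}\,\xi_0>0$ ($*$ denotes conjugate transpose; the condition does not depend on the choice of $R_M^S$). *)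

theory Defs
  imports "HOL-Analysis.Analysis"
begin

definition matA :: "real \<Rightarrow> real \<Rightarrow> real^2^2" where
  "matA F a1 = vector [vector [F, 1], vector [a1 - F\<^sup>2, - F]]"

definition matS :: "real^2^2" where
  "matS = vector [vector [0, 0], vector [0, - 1]]"

definition cmat :: "real^'n^'m \<Rightarrow> complex^'n^'m" where
  "cmat = map_matrix complex_of_real"

definition matM :: "real \<Rightarrow> real \<Rightarrow> real \<Rightarrow> complex \<Rightarrow> complex^2^2" where
  "matM F a1 \<eta> \<xi>0 = matrix_inv (cmat (matA F a1)) ** (cmat (\<eta> *\<^sub>R matS) - mat \<xi>0)"

text \<open>For \<open>\<eta> \<ge> 0\<close> and \<open>Re \<xi>0 > 0\<close> the matrix \<^const>\<open>matM\<close> (with \<open>a1 > 0\<close>) has exactly one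
  eigenvalue with negative real part, so \<open>\<mu>\<close> below is that eigenvalue.\<close>

definition right_stable :: "complex^2^2 \<Rightarrow> complex^2 \<Rightarrow> bool" where
  "right_stable M R \<longleftrightarrow> R \<noteq> 0 \<and> (\<exists>\<mu>. Re \<mu> < 0 \<and> M *v R = \<mu> *s R)"

definition conj_transpose :: "complex^'n^'m \<Rightarrow> complex^'m^'n" where
  "conj_transpose X = map_matrix cnj (transpose X)"

text \<open>The inequality is invariant under scaling of \<open>R\<close>, so quantifying over all right-stable
  \<open>R\<close> amounts to fixing one choice for each \<open>(\<eta>, \<xi>0)\<close>. The determinant under the square root is a
  nonnegative real (it is the Gram determinant of \<open>R\<close>), hence the use of \<^const>\<open>Re\<close>.\<close>

definition GKC :: "real \<Rightarrow> real \<Rightarrow> real^2^1 \<Rightarrow> bool" where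
  "GKC F a1 B \<longleftrightarrow>
    (\<exists>cK>0. \<forall>\<eta>\<ge>0. \<forall>\<xi>0. Re \<xi>0 > 0 \<longrightarrow>
      (\<forall>R. right_stable (matM F a1 \<eta> \<xi>0) R \<longrightarrow>
        (let Rc = (columnvector R :: complex^1^2) in
          cmod (det (cmat B ** Rc)) \<ge> cK * sqrt (Re (det (conj_transpose Rc ** Rc))))))"

end

theory Submission
  imports Defs
begin

text \<open>Put \<open>a = sqrt a1\<close>, so \<open>\<bar>F\<bar> < a\<close>. A right-stable vector \<open>R\<close> has nonzero first component, so
  up to scaling it is \<open>(1, z)\<close>, and \<open>B R\<close> becomes \<open>B\<^sub>u + B\<^sub>p z\<close>. The inequality to be proved is
  \<open>\<bar>B\<^sub>u + B\<^sub>p z\<bar> \<ge> c sqrt (1 + \<bar>z\<bar>\<^sup>2)\<close>, uniformly over the slopes \<open>z\<close> that occur, so the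
  question is where these slopes lie.

  If \<open>\<mu> = - \<nu>\<close> is the stable eigenvalue, the first eigenvector equation gives \<open>z + F = \<xi>0 / \<nu>\<close>. With
  \<open>h = \<eta> / \<nu>\<close> the characteristic equation turns into \<open>h z = a\<^sup>2 - (z + F)\<^sup>2\<close>, where \<open>\<eta>\<close> and
  \<open>\<xi>0\<close> enter only through two sign conditions: \<open>Re h \<ge> 0\<close>, since \<open>Re \<nu> > 0\<close>, and
  \<open>Re ((z + F) * cnj h) = \<eta> * Re \<xi>0 / \<bar>\<nu>\<bar>\<^sup>2 \<ge> 0\<close>. They confine \<open>z\<close> to a bounded part of the
  vertical strip \<open>max F 0 \<le> Re z + F \<le> a\<close> (\<open>eigen_quotient_bounds\<close>).

  Because \<open>B\<close> is real, \<open>Re (B\<^sub>u + B\<^sub>p z)\<close> is an affine function of \<open>Re z\<close>. If its values at the two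
  edges of the strip have the same strict sign, it is bounded away from zero, and the boundedness
  of \<open>z\<close> absorbs the factor \<open>sqrt (1 + \<bar>z\<bar>\<^sup>2)\<close>; this is \<open>GKC_if_no_sign_change\<close>. For \<open>F > 0\<close> the edge
  values are \<open>B\<^sub>u = 1\<close> and \<open>1 + B\<^sub>p (a - F)\<close>. For \<open>F < 0\<close> they are \<open>P = B\<^sub>u - B\<^sub>p F\<close> and a multiple of
  \<open>P\<close> by a factor that the bound on \<open>C\<close> makes positive. In both cases the hypotheses make the two signs agree.\<close>

text \<open>Multiplying the relation between \<open>h\<close> and \<open>z\<close> by \<open>cnj z\<close> expresses \<open>h\<close> through \<open>z\<close>. In
  particular \<open>Im h\<close> and \<open>Im z\<close> have opposite signs, so in the second sign condition the product of
  the imaginary parts can only hurt; this forces \<open>Re z + F > 0\<close>, and it bounds \<open>(Im z)\<^sup>2\<close> by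
  \<open>(Re z + F) * Re h\<close>. The remaining bounds come from \<open>Re h \<ge> 0\<close>. Equality in the second
  condition occurs for \<open>\<eta> = 0\<close>, where \<open>h = 0\<close> and the relation alone would also admit
  \<open>z + F = - a\<close>. In the bound on \<open>\<bar>z\<bar>\<^sup>2\<close> the first part \<open>a\<^sup>2 - F\<^sup>2\<close> suffices for \<open>F > 0\<close>; for \<open>F < 0\<close> the
  other two summands bound \<open>(Re z)\<^sup>2\<close> and \<open>(Im z)\<^sup>2\<close>.\<close>

lemma eigen_quotient_bounds:
  fixes F a :: real and z h :: complex
  assumes aF: "\<bar>F\<bar> < a" and F0: "F \<noteq> 0"
    and hz: "h * z = of_real (a\<^sup>2 - F\<^sup>2) - 2 * of_real F * z - z\<^sup>2"
    and Reh: "Re h \<ge> 0"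
    and pos: "(Re z + F) * Re h + Im z * Im h \<ge> 0"
    and strict: "(Re z + F) * Re h + Im z * Im h = 0 \<longrightarrow> Re z + F > 0"
  shows "max F 0 \<le> Re z + F" and "Re z + F \<le> a"
    and "(cmod z)\<^sup>2 \<le> a\<^sup>2 - F\<^sup>2 + (a + \<bar>F\<bar>)\<^sup>2 + a * (2 * \<bar>F\<bar> + (a\<^sup>2 - F\<^sup>2) / \<bar>F\<bar>)"
proof -
  define x y \<kappa> r where "x = Re z" and "y = Im z" and "\<kappa> = a\<^sup>2 - F\<^sup>2" and "r = x\<^sup>2 + y\<^sup>2"
  have \<kappa>: "\<kappa> > 0"
    using aF abs_le_square_iff[of a F] unfolding \<kappa>_def by linarith
  have "z \<noteq> 0" using hz \<kappa> unfolding \<kappa>_def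
    by (metis diff_zero mult_zero_right of_real_eq_0_iff less_irrefl zero_power2)
  hence r0: "r > 0" unfolding r_def x_def y_def using cmod_power2[of z]
    by (metis zero_less_norm_iff zero_less_power)
  have e1: "Re h * x - Im h * y = \<kappa> - 2 * F * x - (x\<^sup>2 - y\<^sup>2)"
    using arg_cong[OF hz, of Re] by (simp add: x_def y_def \<kappa>_def power2_eq_square)
  have e2: "Re h * y + Im h * x = - 2 * F * y - 2 * x * y"
    using arg_cong[OF hz, of Im] by (simp add: x_def y_def \<kappa>_def power2_eq_square)
  have Rh: "Re h * r = \<kappa> * x - (2 * F + x) * r"
    using e1 e2 unfolding r_def by algebra
  have Ih: "Im h * r = - (\<kappa> + r) * y"
    using e1 e2 unfolding r_def by algebra
  have key: "(x + F) * Re h * r \<ge> (\<kappa> + r) * y\<^sup>2"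
  proof -
    have "((x + F) * Re h + y * Im h) * r \<ge> 0"
      using pos r0 by (simp add: x_def y_def)
    moreover have "y * Im h * r = - (\<kappa> + r) * y\<^sup>2"
      using Ih by algebra
    ultimately show ?thesis by (simp add: algebra_simps)
  qed
  \<comment> \<open>Otherwise both products in the second sign condition are nonpositive, hence their sum is zero,
    and the equality case applies.\<close>
  have w0: "x + F > 0"
  proof (rule ccontr)
    assume n: "\<not> x + F > 0"
    have "(x + F) * Re h \<le> 0" using n Reh by (simp add: mult_nonpos_nonneg)
    moreover have "Im h * y \<le> 0"
    proof -
      have "(Im h * y) * r = - ((\<kappa> + r) * y\<^sup>2)" using Ih by algebra
      also have "\<dots> \<le> 0" using \<kappa> r0 by simp
      finally show ?thesis using r0 by (simp add: mult_le_0_iff)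
    qed
    ultimately show False using pos strict n
      by (simp add: x_def y_def mult.commute)
  qed
  have R: "(2 * F + x) * r \<le> \<kappa> * x" using Rh Reh r0
    by (metis diff_ge_0_iff_ge mult_nonneg_nonneg less_imp_le)
  have rx: "x\<^sup>2 \<le> r" by (simp add: r_def)
  \<comment> \<open>For \<open>F > 0\<close> the region \<open>Re h \<ge> 0\<close> has a component in \<open>x < -2 * F\<close>; it is excluded by
    \<open>x > - F\<close>.\<close>
  have x0: "x \<ge> 0" if "F > 0"
  proof (rule ccontr)
    assume "\<not> x \<ge> 0"
    then have "(2 * F + x) * r > 0" "\<kappa> * x < 0"
      using w0 that r0 \<kappa> by (simp_all add: mult_pos_neg)
    then show False using R by linarith
  qed
  show lo: "max F 0 \<le> Re z + F" using x0 w0 by (cases "F > 0") (auto simp: x_def)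
  have "x + F \<le> a"
  proof (rule ccontr)
    assume n: "\<not> x + F \<le> a"
    then have x: "x > 0" "2 * F + x > 0" using aF by linarith+
    have "(2 * F + x) * x\<^sup>2 \<le> \<kappa> * x"
      using R rx x by (meson mult_left_mono order_trans less_imp_le)
    then have "(2 * F + x) * x \<le> \<kappa>" using x by (simp add: power2_eq_square)
    then have "(x + F)\<^sup>2 \<le> a\<^sup>2" by (simp add: \<kappa>_def power2_eq_square algebra_simps)
    then show False using n aF by (simp add: power2_le_iff_abs_le)
  qed
  then show up: "Re z + F \<le> a" by (simp add: x_def)
  have zr: "(cmod z)\<^sup>2 = r" by (simp add: cmod_power2 r_def x_def y_def)
  have nn: "(a + \<bar>F\<bar>)\<^sup>2 \<ge> 0" "a * (2 * \<bar>F\<bar> + (a\<^sup>2 - F\<^sup>2) / \<bar>F\<bar>) \<ge> 0"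
    using aF \<kappa> by (auto simp: \<kappa>_def)
  show "(cmod z)\<^sup>2 \<le> a\<^sup>2 - F\<^sup>2 + (a + \<bar>F\<bar>)\<^sup>2 + a * (2 * \<bar>F\<bar> + (a\<^sup>2 - F\<^sup>2) / \<bar>F\<bar>)"
  proof (cases "F > 0")
    case True
    have "x \<noteq> 0" using R r0 True by (auto simp: mult_le_0_iff)
    then have x: "x > 0" using x0[OF True] by simp
    have "x * r \<le> (2 * F + x) * r" using True r0 by simp
    also have "\<dots> \<le> \<kappa> * x" by (rule R)
    finally have "r \<le> \<kappa>" using x by (simp add: mult.commute)
    then show ?thesis using zr nn unfolding \<kappa>_def by linarith
  next
    case False
    \<comment> \<open>Now \<open>x\<close> stays above \<open>- F > 0\<close>, which keeps \<open>z\<close> away from the pole of \<open>h\<close> at \<open>z = 0\<close>; so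
      \<open>Re h\<close> is bounded, and with it \<open>y\<close>.\<close>
    define G where "G = - F"
    have G: "G > 0" "\<bar>F\<bar> = G" using False F0 by (auto simp: G_def)
    have xG: "x > G" using w0 by (simp add: G_def)
    have "Re h \<le> 2 * G + \<kappa> / G"
    proof -
      have "G * x \<le> r" using xG G rx
        by (metis less_imp_le mult_right_mono order_trans power2_eq_square)
      then have "\<kappa> * x \<le> (\<kappa> / G) * r" using G \<kappa> by (simp add: field_simps)
      moreover have "x * r \<ge> 0" using xG G r0 by simp
      ultimately have "Re h * r \<le> (2 * G + \<kappa> / G) * r"
        using Rh by (simp add: G_def algebra_simps)
      then show ?thesis using r0 by simp
    qed
    then have "(x + F) * Re h \<le> a * (2 * G + \<kappa> / G)"
      using up w0 Reh aF by (intro mult_mono) (auto simp: x_def)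
    moreover have "y\<^sup>2 \<le> (x + F) * Re h"
    proof -
      have "y\<^sup>2 * r \<le> (\<kappa> + r) * y\<^sup>2" using \<kappa> by (simp add: algebra_simps)
      then have "y\<^sup>2 * r \<le> ((x + F) * Re h) * r" using key by linarith
      then show ?thesis using r0 by simp
    qed
    moreover have "x\<^sup>2 \<le> (a + G)\<^sup>2" using up xG G
      by (intro power_mono) (auto simp: G_def x_def)
    ultimately show ?thesis using zr G \<kappa> by (simp add: r_def \<kappa>_def)
  qed
qed

text \<open>The eigenvector equation multiplied by \<open>A\<close>, so that no entry of \<open>A\<^bsup>-1\<^esup>\<close> appears. It suffices
  that \<open>A\<close> is invertible, which holds as its determinant is \<open>- a1\<close>.\<close>

lemma matM_eigen_equations:
  assumes a1: "a1 \<noteq> 0" and e: "matM F a1 \<eta> \<xi> *v R = \<mu> *s R"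
  shows "(\<xi> + \<mu> * of_real F) * R $ 1 + \<mu> * R $ 2 = 0"
    and "\<mu> * (of_real (a1 - F\<^sup>2)) * R $ 1 + (of_real \<eta> + \<xi> - \<mu> * of_real F) * R $ 2 = 0"
proof -
  let ?A = "cmat (matA F a1)"
  have comp: "?A $ 1 $ 1 = F" "?A $ 1 $ 2 = 1" "?A $ 2 $ 1 = of_real (a1 - F\<^sup>2)" "?A $ 2 $ 2 = - of_real F"
    by (simp_all add: cmat_def matA_def map_matrix_def)
  have "invertible ?A"
    using a1 by (simp add: invertible_det_nz det_2 comp power2_eq_square)
  then have inv: "?A ** matrix_inv ?A = mat 1"
    unfolding invertible_def matrix_inv_def by (rule someI2_ex) simp
  have "?A *v (matM F a1 \<eta> \<xi> *v R) = (cmat (\<eta> *\<^sub>R matS) - mat \<xi>) *v R"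
    by (simp add: matM_def matrix_vector_mul_assoc matrix_mul_assoc inv)
  then have eq: "(cmat (\<eta> *\<^sub>R matS) - mat \<xi>) *v R = ?A *v (\<mu> *s R)"
    using e by simp
  from arg_cong[OF eq, of "\<lambda>v. v $ 1"]
  show "(\<xi> + \<mu> * of_real F) * R $ 1 + \<mu> * R $ 2 = 0"
    by (simp add: matrix_vector_mult_def sum_2 comp)
       (simp add: cmat_def matS_def map_matrix_def mat_def, algebra)
  from arg_cong[OF eq, of "\<lambda>v. v $ 2"]
  show "\<mu> * (of_real (a1 - F\<^sup>2)) * R $ 1 + (of_real \<eta> + \<xi> - \<mu> * of_real F) * R $ 2 = 0"
    by (simp add: matrix_vector_mult_def sum_2 comp)
       (simp add: cmat_def matS_def map_matrix_def mat_def, algebra)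
qed

text \<open>The passage from a right-stable vector to its slope \<open>z = \<xi> / \<nu> - F\<close> and to \<open>h = \<eta> / \<nu>\<close>, where
  \<open>- \<nu>\<close> is the stable eigenvalue. Dividing by \<open>\<nu>\<close> uses the homogeneity of the problem in
  \<open>(\<eta>, \<xi>)\<close>; it makes all later estimates independent of the size of the parameters.\<close>

lemma right_stable_quotient:
  fixes F a :: real
  assumes aF: "\<bar>F\<bar> < a" and \<eta>: "\<eta> \<ge> 0" and \<xi>: "Re \<xi> > 0"
    and R: "right_stable (matM F (a\<^sup>2) \<eta> \<xi>) R"
  obtains z h where "R $ 1 \<noteq> 0" "R $ 2 = R $ 1 * z"
    "h * z = of_real (a\<^sup>2 - F\<^sup>2) - 2 * of_real F * z - z\<^sup>2" "Re h \<ge> 0"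
    "(Re z + F) * Re h + Im z * Im h \<ge> 0"
    "(Re z + F) * Re h + Im z * Im h = 0 \<longrightarrow> Re z + F > 0"
proof -
  obtain \<mu> where R0: "R \<noteq> 0" and \<mu>: "Re \<mu> < 0" and e: "matM F (a\<^sup>2) \<eta> \<xi> *v R = \<mu> *s R"
    using R by (auto simp: right_stable_def)
  define \<nu> where "\<nu> = - \<mu>"
  have \<nu>: "Re \<nu> > 0" "\<nu> \<noteq> 0" using \<mu> by (auto simp: \<nu>_def)
  have a: "a > 0" using aF by linarith
  have "a\<^sup>2 \<noteq> 0" using a by simp
  note eqs = matM_eigen_equations[OF this e]
  have q1: "\<nu> * R $ 2 = (\<xi> - \<nu> * of_real F) * R $ 1"
    and q2: "(of_real \<eta> + \<xi> + \<nu> * of_real F) * R $ 2 = \<nu> * of_real (a\<^sup>2 - F\<^sup>2) * R $ 1"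
    using eqs unfolding \<nu>_def by algebra+
  define z h where "z = \<xi> / \<nu> - of_real F" and "h = of_real \<eta> / \<nu>"
  have "R $ 2 = (\<nu> * R $ 2) / \<nu>" using \<nu> by simp
  also have "\<dots> = R $ 1 * z" unfolding q1 z_def using \<nu> by (simp add: field_simps)
  finally have R2: "R $ 2 = R $ 1 * z" .
  have R1: "R $ 1 \<noteq> 0"
  proof
    assume "R $ 1 = 0"
    with R2 have "R = 0" by (simp add: vec_eq_iff forall_2)
    with R0 show False by simp
  qed
  have xi: "\<xi> = \<nu> * (z + of_real F)" and et: "of_real \<eta> = \<nu> * h"
    using \<nu> by (simp_all add: z_def h_def)
  have "\<nu> * R $ 1 * ((h + (z + of_real F) + of_real F) * z - of_real (a\<^sup>2 - F\<^sup>2)) = 0"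
    using q2 unfolding R2 et unfolding xi by (simp add: algebra_simps)
  then have "(h + (z + of_real F) + of_real F) * z - of_real (a\<^sup>2 - F\<^sup>2) = 0"
    using \<nu> R1 by simp
  then have hz: "h * z = of_real (a\<^sup>2 - F\<^sup>2) - 2 * of_real F * z - z\<^sup>2"
    by (simp add: algebra_simps power2_eq_square)
  have n0: "(cmod \<nu>)\<^sup>2 > 0" using \<nu> by simp
  have Reh: "Re h = \<eta> * Re \<nu> / (cmod \<nu>)\<^sup>2"
    by (simp add: h_def Re_divide cmod_power2)
  have mix: "(Re z + F) * Re h + Im z * Im h = \<eta> * Re \<xi> / (cmod \<nu>)\<^sup>2"
  proof -
    have "(Re z + F) * Re h + Im z * Im h = Re ((z + of_real F) * cnj h)" by simp
    also have "(z + of_real F) * cnj h = of_real (\<eta> / (cmod \<nu>)\<^sup>2) * \<xi>"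
      using \<nu> by (simp add: z_def h_def complex_norm_square field_simps del: of_real_power)
    also have "Re \<dots> = \<eta> / (cmod \<nu>)\<^sup>2 * Re \<xi>" by simp
    finally show ?thesis by simp
  qed
  have st: "Re z + F > 0" if "(Re z + F) * Re h + Im z * Im h = 0"
  proof -
    \<comment> \<open>The root \<open>z + F = - a\<close> would give \<open>\<xi> = - a * \<nu>\<close>, which has negative real part.\<close>
    have "\<eta> = 0" using that mix n0 \<xi> by auto
    then have "h = 0" by (simp add: h_def)
    then have "(z + of_real F)\<^sup>2 = (of_real a)\<^sup>2"
      using hz by (simp add: power2_eq_square algebra_simps)
    then consider "z + of_real F = of_real a" | "z + of_real F = - of_real a"
      using power2_eq_iff by blast
    then show ?thesis
    proof cases
      case 1
      from arg_cong[OF 1, of Re] a show ?thesis by simp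
    next
      case 2
      have "Re \<xi> = - a * Re \<nu>" unfolding xi 2 by simp
      moreover have "a * Re \<nu> > 0" using a \<nu> by simp
      ultimately show ?thesis using \<xi> by simp
    qed
  qed
  show thesis
    by (rule that[OF R1 R2 hz]) (use Reh mix st \<eta> \<xi> \<nu> in auto)
qed

text \<open>An affine function with the same strict sign at both ends of an interval is at least as large in
  modulus, throughout the interval, as at one of the ends. Here the interval is the range of
  \<open>Re z\<close>, and \<open>\<delta> / sqrt (1 + K)\<close> serves as the Kreiss constant: \<open>\<delta>\<close> is the smaller modulus at
  the ends and \<open>K\<close> the bound on \<open>\<bar>z\<bar>\<^sup>2\<close>.\<close>

lemma GKC_if_no_sign_change:
  fixes F a :: real and B :: "real^2^1"
  assumes aF: "\<bar>F\<bar> < a" and F0: "F \<noteq> 0"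
    and sgn: "(B $ 1 $ 1 + B $ 1 $ 2 * (max F 0 - F)) * (B $ 1 $ 1 + B $ 1 $ 2 * (a - F)) > 0"
  shows "GKC F (a\<^sup>2) B"
proof -
  define f where "f x = B $ 1 $ 1 + B $ 1 $ 2 * x" for x
  define l u where "l = max F 0 - F" and "u = a - F"
  define \<delta> where "\<delta> = min \<bar>f l\<bar> \<bar>f u\<bar>"
  define K where "K = a\<^sup>2 - F\<^sup>2 + (a + \<bar>F\<bar>)\<^sup>2 + a * (2 * \<bar>F\<bar> + (a\<^sup>2 - F\<^sup>2) / \<bar>F\<bar>)"
  have fs: "f l * f u > 0" using sgn by (simp add: f_def l_def u_def)
  then have \<delta>: "\<delta> > 0" by (auto simp: \<delta>_def)
  have f\<delta>: "\<bar>f x\<bar> \<ge> \<delta>" if "l \<le> x" "x \<le> u" for x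
  proof (cases "B $ 1 $ 2 \<ge> 0")
    case True
    then have "f l \<le> f x" "f x \<le> f u" using that by (auto simp: f_def mult_left_mono)
    with fs show ?thesis by (auto simp: \<delta>_def zero_less_mult_iff)
  next
    case False
    then have "f u \<le> f x" "f x \<le> f l" using that by (auto simp: f_def mult_left_mono_neg)
    with fs show ?thesis by (auto simp: \<delta>_def zero_less_mult_iff)
  qed
  have K0: "K \<ge> 0"
    using aF abs_le_square_iff[of a F] by (auto simp: K_def intro!: add_nonneg_nonneg mult_nonneg_nonneg divide_nonneg_nonneg)
  have main: "\<delta> / sqrt (1 + K) * sqrt (Re (det (conj_transpose Rc ** Rc))) \<le> cmod (det (cmat B ** Rc))"
    if \<eta>: "\<eta> \<ge> 0" and \<xi>: "Re \<xi> > 0" and R: "right_stable (matM F (a\<^sup>2) \<eta> \<xi>) R"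
      and Rc: "Rc = (columnvector R :: complex^1^2)" for \<eta> \<xi> R Rc
  proof -
    obtain z h where R1: "R $ 1 \<noteq> 0" and R2: "R $ 2 = R $ 1 * z"
      and zh: "h * z = of_real (a\<^sup>2 - F\<^sup>2) - 2 * of_real F * z - z\<^sup>2" "Re h \<ge> 0"
        "(Re z + F) * Re h + Im z * Im h \<ge> 0"
        "(Re z + F) * Re h + Im z * Im h = 0 \<longrightarrow> Re z + F > 0"
      by (rule right_stable_quotient[OF aF \<eta> \<xi> R])
    note bd = eigen_quotient_bounds[OF aF F0 zh]
    have "\<delta> \<le> \<bar>f (Re z)\<bar>" using bd(1,2) by (intro f\<delta>) (auto simp: l_def u_def)
    also have "f (Re z) = Re (of_real (B $ 1 $ 1) + of_real (B $ 1 $ 2) * z)" by (simp add: f_def)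
    also have "\<bar>\<dots>\<bar> \<le> cmod (of_real (B $ 1 $ 1) + of_real (B $ 1 $ 2) * z)" by (rule abs_Re_le_cmod)
    finally have d: "\<delta> \<le> cmod (of_real (B $ 1 $ 1) + of_real (B $ 1 $ 2) * z)" .
    have "det (cmat B ** Rc) = R $ 1 * (of_real (B $ 1 $ 1) + of_real (B $ 1 $ 2) * z)"
      by (simp add: det_1 matrix_matrix_mult_def sum_2 cmat_def map_matrix_def Rc columnvector_def R2 algebra_simps)
    then have num: "cmod (det (cmat B ** Rc)) \<ge> cmod (R $ 1) * \<delta>"
      using d by (simp add: norm_mult mult_left_mono)
    have "det (conj_transpose Rc ** Rc) = of_real ((cmod (R $ 1))\<^sup>2 * (1 + (cmod z)\<^sup>2))"
      by (simp add: det_1 matrix_matrix_mult_def sum_2 conj_transpose_def map_matrix_def transpose_def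
          Rc columnvector_def R2 complex_norm_square algebra_simps del: of_real_power)
    then have "sqrt (Re (det (conj_transpose Rc ** Rc))) = cmod (R $ 1) * sqrt (1 + (cmod z)\<^sup>2)"
      by (simp add: real_sqrt_mult del: of_real_mult of_real_add of_real_power)
    also have "\<dots> \<le> cmod (R $ 1) * sqrt (1 + K)"
      using bd(3) by (intro mult_left_mono) (auto simp: K_def)
    finally have "\<delta> / sqrt (1 + K) * sqrt (Re (det (conj_transpose Rc ** Rc)))
        \<le> \<delta> / sqrt (1 + K) * (cmod (R $ 1) * sqrt (1 + K))"
      using \<delta> K0 by (intro mult_left_mono) auto
    also have "\<dots> = cmod (R $ 1) * \<delta>" using K0 by simp
    finally show ?thesis using num by linarith
  qed
  show ?thesis unfolding GKC_def Let_def
    by (rule exI[of _ "\<delta> / sqrt (1 + K)"]) (use \<delta> K0 main in auto)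
qed

theorem proposition5p1:
  fixes F a1 :: real
  assumes "F \<noteq> 0" and "a1 > 0" and "a1 > F\<^sup>2"
  shows "(F > 0 \<longrightarrow>
           (\<forall>B :: real^2^1. B $ 1 $ 1 = 1 \<and> B $ 1 $ 2 > 1 / (F - sqrt a1) \<longrightarrow> GKC F a1 B))
       \<and> (F < 0 \<longrightarrow>
           (\<forall>(B :: real^2^1) (C :: real).
              rank B = 1 \<and>
              B $ 1 $ 2 * C + B $ 1 $ 1 * (1 - inverse F * C) = 0 \<and>
              C > F - F\<^sup>2 / sqrt a1 \<longrightarrow> GKC F a1 B))"
proof -
  define a where "a = sqrt a1"
  have a1: "a1 = a\<^sup>2" using assms by (simp add: a_def)
  have aF: "\<bar>F\<bar> < a" using assms by (simp add: a_def real_less_rsqrt)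
  show ?thesis
  proof (intro conjI impI allI; (elim conjE)?)
    fix B :: "real^2^1"
    assume F: "F > 0" and Bu: "B $ 1 $ 1 = 1" and Bp: "B $ 1 $ 2 > 1 / (F - sqrt a1)"
    have "1 + B $ 1 $ 2 * (a - F) > 0"
      using Bp aF F by (simp add: a_def[symmetric] field_simps)
    then show "GKC F a1 B"
      unfolding a1 using F Bu by (intro GKC_if_no_sign_change aF) auto
  next
    fix B :: "real^2^1" and C :: real
    assume F: "F < 0" and rk: "rank B = 1"
      and BC: "B $ 1 $ 2 * C + B $ 1 $ 1 * (1 - inverse F * C) = 0"
      and C: "C > F - F\<^sup>2 / sqrt a1"
    define P where "P = B $ 1 $ 1 - B $ 1 $ 2 * F"
    \<comment> \<open>The relation between \<open>B\<close> and \<open>C\<close> says that both entries of \<open>B\<close> are multiples of \<open>P\<close>.\<close>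
    have BuP: "B $ 1 $ 1 * F = P * C"
      using BC F by (simp add: P_def field_simps)
    have P0: "P \<noteq> 0"
    proof
      assume "P = 0"
      with BuP F have "B $ 1 $ 1 = 0" "B $ 1 $ 2 = 0" by (auto simp: P_def)
      then have "B = 0" by (simp add: vec_eq_iff forall_2 forall_1)
      with rk show False by simp
    qed
    \<comment> \<open>The last factor is positive precisely under the lower bound on \<open>C\<close>.\<close>
    have "B $ 1 $ 1 + B $ 1 $ 2 * (a - F) = P * (a / F\<^sup>2 * (F\<^sup>2 / a + C - F))"
    proof -
      have "F\<^sup>2 * B $ 1 $ 2 = P * (C - F)"
        using BuP by (simp add: P_def algebra_simps power2_eq_square)
      then have "B $ 1 $ 2 = P * ((C - F) / F\<^sup>2)" using F by (simp add: field_simps)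
      then have "B $ 1 $ 1 + B $ 1 $ 2 * (a - F) = P * (1 + a * ((C - F) / F\<^sup>2))"
        unfolding P_def by algebra
      also have "1 + a * ((C - F) / F\<^sup>2) = a / F\<^sup>2 * (F\<^sup>2 / a + C - F)"
        using F aF by (simp add: field_simps)
      finally show ?thesis .
    qed
    moreover have "a / F\<^sup>2 * (F\<^sup>2 / a + C - F) > 0"
      using C F aF by (simp add: a_def[symmetric])
    ultimately obtain k where "k > 0" "B $ 1 $ 1 + B $ 1 $ 2 * (a - F) = P * k"
      by blast
    then have "P * (B $ 1 $ 1 + B $ 1 $ 2 * (a - F)) > 0"
      using P0 by (simp add: mult.assoc[symmetric] flip: power2_eq_square)
    then show "GKC F a1 B"
      unfolding a1 using F by (intro GKC_if_no_sign_change aF) (auto simp: P_def)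
  qed
qed

end
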